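(* Let $\mathcal A$ be a finite set of alternatives and consider Mallows' model with dispersion $0<\varphi<1$ and $n\ge 1$ i.i.d. rankings. For any $K\in\mathbb N$, any $a\in\mathcal A$, any $W\in\mathcal L(\mathcal A)$, and any $C,C'\subseteq\mathcal A\setminus\{a\}$ such that $C$ dominates $C'$ with respect to $W$, $$\pi_W(\{P: w_P(C'\succ a)\ge K\})\le\pi_W(\{P: w_P(C\succ a)\ge K\}).$$
   Context: $\mathcal L(\mathcal A)$ is the set of all linear orders (rankings) over $\mathcal A$; $b\succ_V c$ means $b$ is preferred to $c$ in $V$. The Kendall-tau distance $\mathrm{KT}(V,W)$ is the number of unordered pairs of alternatives on which $V$ and $W$ disagree. Mallows' model with fixed dispersion $\varphi$: sample space $\mathcal L(\mathcal A)^n$, parameter space $\mathcal L(\mathcal A)$; given parameter $W$, the $n$ rankings are i.i.d. with $\pi_W(V)=\frac1Z\varphi^{\mathrm{KT}(V,W)}$, $Z$ the normalization factor. For a profile $P\in\mathcal L(\mathcal A)^n$, $P(b\succ c)$ is the number of votes in $P$ in which $b$ is preferred to $c$; $w_P(b\succ c)=P(b\succ c)-P(c\succ b)$; for $B\subseteq\mathcal A\setminus\{a\}$, $w_P(B\succ a)=\sum_{b\in B}w_P(b\succ a)$. For $C,C'\subseteq\mathcal A$ with $C\ne C'$ and $|C|=|C'|$, $C$ dominates $C'$ with respect to $W\in\mathcal L(\mathcal A)$ if there is a one-to-one mapping $F:(C\setminus C')\to(C'\setminus C)$ such that $c\succ_W F(c)$ for all $c\in C\setminus C'$. *)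

theory Defs
  imports "HOL-Probability.Probability"
begin

text \<open>
  A ranking of \<open>A\<close> is a (reflexive) linear order in the sense of the library, with the
  orientation \<open>(b, c) \<in> V\<close> iff \<open>b\<close> is ranked at least as high as \<open>c\<close> in \<open>V\<close>.
\<close>

definition rankings :: "'a set \<Rightarrow> 'a rel set" where
  "rankings A = {V. linear_order_on A V}"

definition prefers :: "'a rel \<Rightarrow> 'a \<Rightarrow> 'a \<Rightarrow> bool" where
  "prefers V b c \<longleftrightarrow> (b, c) \<in> V \<and> b \<noteq> c"

text \<open>Each unordered pair is represented by the two-element set \<open>{b, c}\<close>, so it is counted once.\<close>

definition KT :: "'a rel \<Rightarrow> 'a rel \<Rightarrow> nat" where
  "KT V W = card {{b, c} | b c. prefers V b c \<and> prefers W c b}"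

definition mallows_Z :: "'a set \<Rightarrow> real \<Rightarrow> 'a rel \<Rightarrow> real" where
  "mallows_Z A \<phi> W = (\<Sum>V\<in>rankings A. \<phi> ^ KT V W)"

text \<open>
  The mass function below is a genuine one only for finite \<open>A\<close>, \<open>\<phi> > 0\<close> and \<open>W \<in> rankings A\<close>;
  see \<open>pmf_mallows\<close>.
\<close>

definition mallows :: "'a set \<Rightarrow> real \<Rightarrow> 'a rel \<Rightarrow> 'a rel pmf" where
  "mallows A \<phi> W =
     embed_pmf (\<lambda>V. if V \<in> rankings A then \<phi> ^ KT V W / mallows_Z A \<phi> W else 0)"

definition profiles :: "'a set \<Rightarrow> nat \<Rightarrow> 'a rel list set" where
  "profiles A n = {P. set P \<subseteq> rankings A \<and> length P = n}"

definition mallows_profile :: "'a set \<Rightarrow> real \<Rightarrow> nat \<Rightarrow> 'a rel \<Rightarrow> 'a rel list pmf" where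
  "mallows_profile A \<phi> n W = replicate_pmf n (mallows A \<phi> W)"

definition votes :: "'a rel list \<Rightarrow> 'a \<Rightarrow> 'a \<Rightarrow> nat" where
  "votes P b c = card {i. i < length P \<and> prefers (P ! i) b c}"

definition margin :: "'a rel list \<Rightarrow> 'a \<Rightarrow> 'a \<Rightarrow> int" where
  "margin P b c = int (votes P b c) - int (votes P c b)"

definition set_margin :: "'a rel list \<Rightarrow> 'a set \<Rightarrow> 'a \<Rightarrow> int" where
  "set_margin P B a = (\<Sum>b\<in>B. margin P b a)"

definition dominates :: "'a rel \<Rightarrow> 'a set \<Rightarrow> 'a set \<Rightarrow> bool" where
  "dominates W C C' \<longleftrightarrow> C \<noteq> C' \<and> card C = card C' \<and>
     (\<exists>F. inj_on F (C - C') \<and> F ` (C - C') \<subseteq> C' - C \<and> (\<forall>c\<in>C - C'. prefers W c (F c)))"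

lemma finite_rankings: "finite A \<Longrightarrow> finite (rankings A)"
  by (rule finite_subset[of _ "Pow (A \<times> A)"])
    (auto simp: rankings_def linear_order_on_def dest!: partial_order_onD(4))

lemma mallows_Z_pos:
  assumes "finite A" "\<phi> > 0" "W \<in> rankings A"
  shows "mallows_Z A \<phi> W > 0"
  unfolding mallows_Z_def
  by (rule sum_pos) (use assms finite_rankings[OF assms(1)] in auto)

lemma pmf_mallows:
  assumes "finite A" "\<phi> > 0" "W \<in> rankings A"
  shows "pmf (mallows A \<phi> W) V =
           (if V \<in> rankings A then \<phi> ^ KT V W / mallows_Z A \<phi> W else 0)"
proof -
  let ?f = "\<lambda>V. if V \<in> rankings A then \<phi> ^ KT V W / mallows_Z A \<phi> W else 0"
  note Z = mallows_Z_pos[OF assms] and fin = finite_rankings[OF assms(1)]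
  have nonneg: "?f V \<ge> 0" for V
    using Z assms(2) by simp
  have "(\<integral>\<^sup>+V. ennreal (?f V) \<partial>count_space UNIV) = (\<Sum>V\<in>rankings A. ennreal (?f V))"
    by (rule nn_integral_count_space'[OF fin]) auto
  also have "\<dots> = ennreal (\<Sum>V\<in>rankings A. ?f V)"
    using nonneg by (rule sum_ennreal)
  also have "(\<Sum>V\<in>rankings A. ?f V) = 1"
    using Z by (simp add: sum_divide_distrib[symmetric] mallows_Z_def[symmetric])
  finally show ?thesis
    unfolding mallows_def using nonneg by (subst pmf_embed_pmf) auto
qed

lemma set_pmf_mallows:
  assumes "finite A" "\<phi> > 0" "W \<in> rankings A"
  shows "set_pmf (mallows A \<phi> W) = rankings A"
  using mallows_Z_pos[OF assms] assms(2) by (auto simp: set_pmf_eq pmf_mallows[OF assms])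

lemma set_pmf_mallows_profile:
  assumes "finite A" "\<phi> > 0" "W \<in> rankings A"
  shows "set_pmf (mallows_profile A \<phi> n W) = profiles A n"
  by (auto simp: mallows_profile_def profiles_def set_replicate_pmf set_pmf_mallows[OF assms])

end

theory Submission
  imports Defs "HOL-Combinatorics.Transposition"
begin

text \<open>
  The margin of a profile against \<open>a\<close> is a sum of independent contributions, one for each
  vote, and first-order stochastic dominance is preserved under independent sums
  (\<open>prob_sum_list_replicate_pmf_mono\<close>). Hence it suffices to compare the contributions of
  a single vote, and there \<open>C\<close> can be transformed into \<open>C'\<close> by replacing one alternative
  \<open>c\<close> by \<open>F c\<close> at a time.

  So let \<open>C = D \<union> {c}\<close> and \<open>C' = D \<union> {c'}\<close> with \<open>c\<close> preferred to \<open>c'\<close> in \<open>W\<close>. Exchanging the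
  names of \<open>c\<close> and \<open>c'\<close> is an involution on rankings which interchanges the contributions of
  \<open>C\<close> and \<open>C'\<close>. In each pair of rankings that this involution matches, the one with \<open>c\<close> above
  \<open>c'\<close> gives \<open>C\<close> at least the contribution of \<open>C'\<close>, and by \<open>KT_le_KT_exchange\<close> it is no
  farther from \<open>W\<close> than its partner, hence at least as likely. So within each
  pair the probability mass leans towards the ranking that favours \<open>C\<close> over \<open>C'\<close>
  (\<open>expectation_exchange_mono\<close>).
\<close>

section \<open>Relabelled rankings and the Kendall-tau distance\<close>

lemma prefers_trans:
  assumes "V \<in> rankings A" "prefers V x y" "prefers V y z"
  shows "prefers V x z"
  using assms unfolding rankings_def prefers_def order_on_defs trans_def antisym_def by blast

lemma prefers_antisym:
  assumes "V \<in> rankings A" "prefers V x y"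
  shows "\<not> prefers V y x"
  using assms unfolding rankings_def prefers_def order_on_defs antisym_def by blast

lemma prefers_total:
  assumes "V \<in> rankings A" "x \<in> A" "y \<in> A" "x \<noteq> y"
  shows "prefers V x y \<or> prefers V y x"
  using assms unfolding rankings_def prefers_def order_on_defs total_on_def by blast

lemma prefers_in:
  assumes "V \<in> rankings A" "prefers V x y"
  shows "x \<in> A" "y \<in> A"
  using assms unfolding rankings_def prefers_def order_on_defs by blast+

abbreviation exchange :: "'a \<Rightarrow> 'a \<Rightarrow> 'a rel \<Rightarrow> 'a rel" where
  "exchange c c' V \<equiv> inv_image V (Transposition.transpose c c')"

lemma exchange_exchange [simp]: "exchange c c' (exchange c c' V) = V"
  by (auto simp: inv_image_def)

lemma prefers_exchange:
  "prefers (exchange c c' V) x y \<longleftrightarrow>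
     prefers V (Transposition.transpose c c' x) (Transposition.transpose c c' y)"
  by (simp add: prefers_def) (metis transpose_involutory)

lemma exchange_in_rankings:
  assumes "V \<in> rankings A" "c \<in> A" "c' \<in> A"
  shows "exchange c c' V \<in> rankings A"
proof -
  have iff: "Transposition.transpose c c' x \<in> A \<longleftrightarrow> x \<in> A" for x
    using assms(2,3) by (auto simp: Transposition.transpose_def)
  have inj: "Transposition.transpose c c' x = Transposition.transpose c c' y \<longleftrightarrow> x = y" for x y
    by (metis transpose_involutory)
  have V: "V \<subseteq> A \<times> A" "refl_on A V" "trans V" "antisym V" "total_on A V"
    using assms(1) by (auto simp: rankings_def order_on_defs)
  have "exchange c c' V \<subseteq> A \<times> A"
    using V(1) iff by (auto simp: inv_image_def)
  moreover have "refl_on A (exchange c c' V)"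
    using V(2) iff by (simp add: refl_on_def)
  moreover have "trans (exchange c c' V)"
    using V(3) by (rule trans_inv_image)
  moreover have "antisym (exchange c c' V)"
    using V(4) inj unfolding antisym_def in_inv_image by metis
  moreover have "total_on A (exchange c c' V)"
    using V(5) iff inj unfolding total_on_def in_inv_image by metis
  ultimately show ?thesis
    by (simp add: rankings_def order_on_defs)
qed

text \<open>Ordered pairs are easier to map injectively than two-element sets.\<close>

lemma KT_eq_card_inversions:
  assumes "V \<in> rankings A"
  shows "KT V W = card {(x, y). prefers V x y \<and> prefers W y x}"
proof -
  let ?N = "{(x, y). prefers V x y \<and> prefers W y x}"
  have "inj_on (\<lambda>(x, y). {x, y}) ?N"
    using prefers_antisym[OF assms] by (auto simp: inj_on_def doubleton_eq_iff)
  moreover have "(\<lambda>(x, y). {x, y}) ` ?N = {{b, c} |b c. prefers V b c \<and> prefers W c b}"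
    by auto
  ultimately show ?thesis
    unfolding KT_def by (auto dest: card_image)
qed

text \<open>
  An inversion \<open>(x, y)\<close> of \<open>V\<close> that disappears after the exchange must involve exactly one of
  \<open>c\<close> and \<open>c'\<close>. Renaming \<open>c\<close> to \<open>c'\<close>, or \<open>c'\<close> to \<open>c\<close>, in that pair then gives an inversion of
  the exchanged ranking that was not one before, so at least as many inversions are created
  as are lost.
\<close>

lemma KT_le_KT_exchange:
  assumes "finite A" "V \<in> rankings A" "W \<in> rankings A" "prefers V c c'" "prefers W c c'"
  shows "KT V W \<le> KT (exchange c c' V) W"
proof -
  let ?t = "Transposition.transpose c c'"
  let ?V' = "exchange c c' V"
  let ?N = "\<lambda>V. {(x, y). prefers V x y \<and> prefers W y x}"
  have V': "?V' \<in> rankings A"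
    using assms prefers_in by (metis exchange_in_rankings)
  have fin: "finite (?N U)" if "U \<in> rankings A" for U
    by (rule finite_subset[of _ "A \<times> A"]) (use assms(1) prefers_in[OF that] in auto)
  have renamed: "prefers W (?t y) (?t x)"
    if xy: "prefers V x y" "prefers W y x" and lost: "\<not> prefers V (?t x) (?t y)" for x y
  proof -
    have ne: "x \<noteq> y" "c \<noteq> c'"
      using xy(1) assms(4) by (auto simp: prefers_def)
    have not_top: "(x, y) \<noteq> (c, c')"
      using xy(2) prefers_antisym[OF assms(3,5)] by blast
    have not_bot: "(x, y) \<noteq> (c', c)"
      using xy(1) prefers_antisym[OF assms(2,4)] by blast
    consider "x = c" "y \<noteq> c" "y \<noteq> c'" | "y = c'" "x \<noteq> c" "x \<noteq> c'"
      | "x = c'" "y \<noteq> c" "y \<noteq> c'" | "y = c" "x \<noteq> c" "x \<noteq> c'"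
      | "x \<noteq> c" "x \<noteq> c'" "y \<noteq> c" "y \<noteq> c'"
      using ne not_top not_bot by blast
    then show ?thesis
    proof cases
      case 1
      then show ?thesis
        using prefers_trans[OF assms(3) xy(2)] assms(5) by simp
    next
      case 2
      then show ?thesis
        using prefers_trans[OF assms(3,5)] xy(2) by simp
    next
      case 3
      then have "prefers V (?t x) (?t y)"
        using prefers_trans[OF assms(2,4)] xy(1) by simp
      then show ?thesis
        using lost by blast
    next
      case 4
      then have "prefers V (?t x) (?t y)"
        using prefers_trans[OF assms(2) xy(1)] assms(4) by simp
      then show ?thesis
        using lost by blast
    next
      case 5
      then show ?thesis
        using lost xy(1) by simp
    qed
  qed
  have created: "map_prod ?t ?t ` (?N V - ?N ?V') \<subseteq> ?N ?V' - ?N V"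
    using renamed by (auto simp: prefers_exchange)
  have "inj (map_prod ?t ?t)"
    by (intro prod.inj_map inj_transpose)
  then have "inj_on (map_prod ?t ?t) (?N V - ?N ?V')"
    by (rule inj_on_subset) simp
  then have "card (?N V - ?N ?V') = card (map_prod ?t ?t ` (?N V - ?N ?V'))"
    by (rule card_image[symmetric])
  also have "\<dots> \<le> card (?N ?V' - ?N V)"
    using created fin[OF V'] by (intro card_mono) auto
  finally have less: "card (?N V - ?N ?V') \<le> card (?N ?V' - ?N V)" .
  have "card (?N V) = card (?N V \<inter> ?N ?V') + card (?N V - ?N ?V')"
    by (rule card_Int_Diff[OF fin[OF assms(2)]])
  also have "\<dots> \<le> card (?N ?V' \<inter> ?N V) + card (?N ?V' - ?N V)"
    using less by (simp add: Int_commute)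
  also have "\<dots> = card (?N ?V')"
    by (rule card_Int_Diff[OF fin[OF V'], symmetric])
  finally show ?thesis
    by (simp add: KT_eq_card_inversions[OF assms(2)] KT_eq_card_inversions[OF V'])
qed

section \<open>The contribution of a single vote\<close>

definition vote_margin :: "'a rel \<Rightarrow> 'a set \<Rightarrow> 'a \<Rightarrow> int" where
  "vote_margin V B a = (\<Sum>b\<in>B. of_bool (prefers V b a) - of_bool (prefers V a b))"

lemma votes_Cons: "votes (V # P) b c = of_bool (prefers V b c) + votes P b c"
proof -
  have "votes P b c = length (filter (\<lambda>V. prefers V b c) P)" for P
    by (simp add: votes_def length_filter_conv_card)
  then show ?thesis
    by simp
qed

lemma set_margin_eq_sum_list: "set_margin P B a = sum_list (map (\<lambda>V. vote_margin V B a) P)"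
proof (induction P)
  case Nil
  then show ?case
    by (simp add: set_margin_def margin_def votes_def)
next
  case (Cons V P)
  have "set_margin (V # P) B a = vote_margin V B a + set_margin P B a"
    unfolding set_margin_def margin_def vote_margin_def votes_Cons sum.distrib[symmetric]
    by (intro sum.cong) auto
  then show ?case
    using Cons.IH by simp
qed

lemma vote_margin_exchange:
  assumes "c \<noteq> a" "c' \<noteq> a" "c \<notin> D" "c' \<notin> D"
  shows "vote_margin (exchange c c' V) (insert c D) a = vote_margin V (insert c' D) a"
    and "vote_margin (exchange c c' V) (insert c' D) a = vote_margin V (insert c D) a"
proof -
  let ?t = "Transposition.transpose c c'"
  have margin: "vote_margin (exchange c c' V) B a = vote_margin V (?t ` B) a" for B
    using assms(1,2) by (simp add: vote_margin_def prefers_exchange sum.reindex)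
  have "?t ` D = D"
    using assms(3,4) by simp
  then have "?t ` insert c D = insert c' D" "?t ` insert c' D = insert c D"
    by simp_all
  then show "vote_margin (exchange c c' V) (insert c D) a = vote_margin V (insert c' D) a"
    and "vote_margin (exchange c c' V) (insert c' D) a = vote_margin V (insert c D) a"
    using margin by metis+
qed

lemma vote_margin_insert_mono:
  assumes "V \<in> rankings A" "finite D" "c \<notin> D" "c' \<notin> D" "c \<noteq> a" "c' \<noteq> a"
    and "prefers V c c'"
  shows "vote_margin V (insert c' D) a \<le> vote_margin V (insert c D) a"
proof -
  have "prefers V c' a \<longrightarrow> prefers V c a" "prefers V a c \<longrightarrow> prefers V a c'"
    using prefers_trans[OF assms(1)] assms(7) by blast+
  then show ?thesis
    using assms(2-4) by (auto simp: vote_margin_def)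
qed

section \<open>Stochastic dominance for a single vote\<close>

text \<open>
  Let \<open>\<delta> V\<close> be the gain, measured by \<open>g\<close>, of \<open>insert c D\<close> over \<open>insert c' D\<close> in the vote \<open>V\<close>. The
  exchange of names changes only the sign of \<open>\<delta>\<close>. Averaging the expectation of \<open>\<delta>\<close> with its
  reindexed form therefore gives half the sum of \<open>(p V - p (exchange c c' V)) * \<delta> V\<close>, whose
  factors never have opposite signs: both are nonnegative if \<open>V\<close> has \<open>c\<close> above \<open>c'\<close>, and the
  exchange negates both.
\<close>

lemma expectation_exchange_mono:
  fixes g :: "int \<Rightarrow> real"
  assumes "finite A" "0 < \<phi>" "\<phi> < 1" "W \<in> rankings A"
    and D: "finite D" "c \<notin> D" "c' \<notin> D" and ne: "c \<noteq> a" "c' \<noteq> a"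
    and "prefers W c c'" and "mono g"
  shows "measure_pmf.expectation (mallows A \<phi> W) (\<lambda>V. g (vote_margin V (insert c' D) a))
       \<le> measure_pmf.expectation (mallows A \<phi> W) (\<lambda>V. g (vote_margin V (insert c D) a))"
proof -
  let ?p = "pmf (mallows A \<phi> W)"
  let ?x = "exchange c c'"
  define \<delta> where
    "\<delta> V = g (vote_margin V (insert c D) a) - g (vote_margin V (insert c' D) a)" for V
  have c: "c \<in> A" "c' \<in> A" "c \<noteq> c'"
    using prefers_in[OF assms(4,10)] assms(10) by (auto simp: prefers_def)
  note x_in = exchange_in_rankings[OF _ c(1,2)]
  have \<delta>_x: "\<delta> (?x V) = - \<delta> V" for V
    using vote_margin_exchange[OF ne D(2,3)] by (simp add: \<delta>_def)
  have upper: "0 \<le> (?p V - ?p (?x V)) * \<delta> V" if V: "V \<in> rankings A" and "prefers V c c'" for V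
  proof (rule mult_nonneg_nonneg)
    have "KT V W \<le> KT (?x V) W"
      by (rule KT_le_KT_exchange[OF assms(1) V assms(4) that(2) assms(10)])
    then have "\<phi> ^ KT (?x V) W \<le> \<phi> ^ KT V W"
      using assms(2,3) by (simp add: power_decreasing)
    then show "0 \<le> ?p V - ?p (?x V)"
      using V x_in[OF V] mallows_Z_pos[OF assms(1,2,4)]
      by (simp add: pmf_mallows[OF assms(1,2,4)] divide_right_mono)
    show "0 \<le> \<delta> V"
      using vote_margin_insert_mono[OF V D ne that(2)] \<open>mono g\<close>
      by (simp add: \<delta>_def monoD)
  qed
  have pair: "0 \<le> (?p V - ?p (?x V)) * \<delta> V" if V: "V \<in> rankings A" for V
  proof (cases "prefers V c c'")
    case False
    then have "prefers (?x V) c c'"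
      using prefers_total[OF V c] by (simp add: prefers_exchange)
    then have "0 \<le> (?p (?x V) - ?p V) * - \<delta> V"
      using upper[OF x_in[OF V]] by (simp add: \<delta>_x)
    then show ?thesis
      by (simp add: algebra_simps)
  qed (use upper V in blast)
  have E: "measure_pmf.expectation (mallows A \<phi> W) f = (\<Sum>V\<in>rankings A. f V * ?p V)"
    for f :: "'a rel \<Rightarrow> real"
    using finite_rankings[OF assms(1)] set_pmf_mallows[OF assms(1,2,4)]
    by (intro integral_measure_pmf_real) auto
  have "(\<Sum>V\<in>rankings A. \<delta> V * ?p V) = (\<Sum>V\<in>rankings A. \<delta> (?x V) * ?p (?x V))"
    by (rule sum.reindex_bij_witness[of _ ?x ?x]) (auto intro: x_in)
  then have "2 * (\<Sum>V\<in>rankings A. \<delta> V * ?p V) = (\<Sum>V\<in>rankings A. (?p V - ?p (?x V)) * \<delta> V)"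
    by (simp add: \<delta>_x sum_negf sum_subtractf algebra_simps)
  also have "\<dots> \<ge> 0"
    by (rule sum_nonneg) (rule pair)
  finally have "0 \<le> (\<Sum>V\<in>rankings A. \<delta> V * ?p V)"
    by simp
  then show ?thesis
    by (simp add: E \<delta>_def left_diff_distrib sum_subtractf)
qed

text \<open>
  The sets \<open>C - S \<union> F ` S\<close> for growing \<open>S \<subseteq> C - C'\<close> lead from \<open>C\<close> to \<open>C'\<close>, and each step is a
  single replacement of \<open>c\<close> by \<open>F c\<close>. Injectivity of \<open>F\<close> ensures that \<open>F c\<close> is new in that step,
  and \<open>card C = card C'\<close> ensures that \<open>C' - C\<close> is exhausted at the end.
\<close>

lemma expectation_vote_margin_mono:
  fixes g :: "int \<Rightarrow> real"
  assumes "finite A" "0 < \<phi>" "\<phi> < 1" "W \<in> rankings A"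
    and C: "C \<subseteq> A - {a}" "C' \<subseteq> A - {a}" and "dominates W C C'" and "mono g"
  shows "measure_pmf.expectation (mallows A \<phi> W) (\<lambda>V. g (vote_margin V C' a))
       \<le> measure_pmf.expectation (mallows A \<phi> W) (\<lambda>V. g (vote_margin V C a))"
proof -
  define E where "E B = measure_pmf.expectation (mallows A \<phi> W) (\<lambda>V. g (vote_margin V B a))" for B
  obtain F where card: "card C = card C'" and F: "inj_on F (C - C')" "F ` (C - C') \<subseteq> C' - C"
    and pref: "\<And>c. c \<in> C - C' \<Longrightarrow> prefers W c (F c)"
    using assms(7) unfolding dominates_def by blast
  have fin: "finite C" "finite C'"
    using C assms(1) by (meson finite_Diff finite_subset)+
  have replaced: "E (C - S \<union> F ` S) \<le> E C" if "finite S" "S \<subseteq> C - C'" for S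
    using that
  proof (induction S rule: finite_induct)
    case empty
    then show ?case
      by simp
  next
    case (insert c S)
    define D where "D = C - insert c S \<union> F ` S"
    have c: "c \<in> C - C'" and S: "S \<subseteq> C - C'"
      using insert.prems by auto
    have Fc: "F c \<in> C' - C"
      using F(2) c by blast
    have FS: "F ` S \<subseteq> C' - C"
      using F(2) S by blast
    have "F c \<notin> F ` S"
      using F(1) c S insert.hyps(2) by (auto dest: inj_onD)
    then have D: "finite D" "c \<notin> D" "F c \<notin> D"
      using fin insert.hyps(1) Fc FS c by (auto simp: D_def)
    have ne: "c \<noteq> a" "F c \<noteq> a"
      using C c Fc by auto
    have "E (insert (F c) D) \<le> E (insert c D)"
      unfolding E_def by (rule expectation_exchange_mono[OF assms(1-4) D ne pref[OF c] assms(8)])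
    moreover have "insert (F c) D = C - insert c S \<union> F ` insert c S"
      by (auto simp: D_def)
    moreover have "insert c D = C - S \<union> F ` S"
      using c insert.hyps(2) by (auto simp: D_def)
    ultimately show ?case
      using insert.IH[OF S] by simp
  qed
  have "card (C - C') = card (C' - C)"
    using card fin card_le_sym_Diff[of C C'] card_le_sym_Diff[of C' C] by simp
  then have "F ` (C - C') = C' - C"
    using F fin by (intro card_subset_eq) (auto simp: card_image)
  then have "C - (C - C') \<union> F ` (C - C') = C'"
    by auto
  then show ?thesis
    using replaced[of "C - C'"] fin by (simp add: E_def)
qed

section \<open>Independent sums\<close>

lemma measure_bind_pmf:
  "measure_pmf.prob (bind_pmf p f) X = (\<integral>x. measure_pmf.prob (f x) X \<partial>measure_pmf p)"
  unfolding measure_pmf_bind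
  by (rule measure_pmf.measure_bind[where N = "count_space UNIV"])
    (auto simp: Pi_def measure_subprob)

text \<open>
  By conditioning on the first summand: the probability that the rest reaches the remaining
  threshold is a monotone function of the first summand. The hypothesis is stated for monotone test
  functions because it is applied to exactly this function.
\<close>

lemma prob_sum_list_replicate_pmf_mono:
  fixes f h :: "'b \<Rightarrow> int" and p :: "'b pmf"
  assumes dom: "\<And>g :: int \<Rightarrow> real. mono g \<Longrightarrow> range g \<subseteq> {0..1} \<Longrightarrow>
      measure_pmf.expectation p (\<lambda>x. g (h x)) \<le> measure_pmf.expectation p (\<lambda>x. g (f x))"
  shows "measure_pmf.prob (replicate_pmf n p) {xs. k \<le> sum_list (map h xs)}
       \<le> measure_pmf.prob (replicate_pmf n p) {xs. k \<le> sum_list (map f xs)}"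
proof (induction n arbitrary: k)
  case 0
  then show ?case
    by (simp add: indicator_def)
next
  case (Suc n)
  define Q where
    "Q u k = measure_pmf.prob (replicate_pmf n p) {xs. k \<le> sum_list (map u xs)}"
    for u :: "'b \<Rightarrow> int" and k
  have Q01: "0 \<le> Q u k" "Q u k \<le> 1" for u k
    by (simp_all add: Q_def)
  have split_first: "measure_pmf.prob (replicate_pmf (Suc n) p) {xs. k \<le> sum_list (map u xs)}
      = measure_pmf.expectation p (\<lambda>x. Q u (k - u x))" for u :: "'b \<Rightarrow> int"
  proof -
    have "replicate_pmf (Suc n) p = bind_pmf p (\<lambda>x. map_pmf ((#) x) (replicate_pmf n p))"
      by (simp add: map_pmf_def)
    then show ?thesis
      by (simp add: measure_bind_pmf Q_def vimage_def algebra_simps)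
  qed
  have "mono (\<lambda>t. Q h (k - t))"
    unfolding Q_def by (intro monoI measure_pmf.finite_measure_mono) auto
  then have "measure_pmf.expectation p (\<lambda>x. Q h (k - h x))
      \<le> measure_pmf.expectation p (\<lambda>x. Q h (k - f x))"
    using Q01 by (intro dom) auto
  also have "\<dots> \<le> measure_pmf.expectation p (\<lambda>x. Q f (k - f x))"
  proof (rule integral_mono)
    show "integrable (measure_pmf p) (\<lambda>x. Q u (k - f x))" for u
      using Q01 by (intro measure_pmf.integrable_const_bound[where B = 1]) auto
    then show "integrable (measure_pmf p) (\<lambda>x. Q f (k - f x))" .
    show "Q h (k - f x) \<le> Q f (k - f x)" for x
      using Suc.IH by (simp add: Q_def)
  qed
  finally show ?case
    by (simp only: split_first)
qed

theorem lemma5: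
  fixes A :: "'a set" and \<phi> :: real and n K :: nat and a :: 'a
    and W :: "'a rel" and C C' :: "'a set"
  assumes "finite A" and "0 < \<phi>" and "\<phi> < 1" and "n \<ge> 1"
    and "a \<in> A" and "W \<in> rankings A"
    and "C \<subseteq> A - {a}" and "C' \<subseteq> A - {a}"
    and "dominates W C C'"
  shows "measure_pmf.prob (mallows_profile A \<phi> n W) {P \<in> profiles A n. set_margin P C' a \<ge> int K}
       \<le> measure_pmf.prob (mallows_profile A \<phi> n W) {P \<in> profiles A n. set_margin P C a \<ge> int K}"
proof -
  have on_all_lists:
    "measure_pmf.prob (mallows_profile A \<phi> n W) {P \<in> profiles A n. set_margin P B a \<ge> int K}
     = measure_pmf.prob (replicate_pmf n (mallows A \<phi> W))
         {P. int K \<le> sum_list (map (\<lambda>V. vote_margin V B a) P)}" for B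
    unfolding mallows_profile_def[symmetric] set_margin_eq_sum_list
    using set_pmf_mallows_profile[OF assms(1,2,6), of n]
    by (intro measure_pmf.finite_measure_eq_AE) (auto simp: AE_measure_pmf_iff)
  show ?thesis
    unfolding on_all_lists
    by (intro prob_sum_list_replicate_pmf_mono expectation_vote_margin_mono[OF assms(1-3,6-9)])
qed

end
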